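(* Let $(X,d)$ be a compact metric space, let $f\colon X\to X$ be continuous and let $\Lambda\subseteq X$ be closed (but not necessarily invariant). The following are equivalent: (1) $f$ is open on a neighbourhood of $\Lambda$ and $f$ is expanding on a neighbourhood of $\Lambda$; (2) $f$ is ball expanding on a neighbourhood of $\Lambda$ and $f$ is locally one-to-one on $\Lambda$ (equivalently, on a neighbourhood of $\Lambda$).
   Context: $B_\varepsilon(x)=\{y\in X: d(x,y)<\varepsilon\}$ denotes the open ball. Let $f\colon X\to X$ be continuous. Open: $f$ is open at $x\in X$ if for every neighbourhood $U$ of $x$ one has $f(x)\in\operatorname{int}(f(U))$. For a subset $A\subseteq X$, $f$ is open on $A$ if $f$ is open at every $x\in A$. Locally one-to-one: $f$ is locally one-to-one at $x$ if there is an open set $V\ni x$ such that the restriction $f|_V$ is injective; $f$ is locally one-to-one on $A\subseteq X$ if it is locally one-to-one at every $x\in A$. (If this holds on $A$, it holds on an open neighbourhood of $A$.) Expanding: $f$ is expanding on $A\subseteq X$ if there are $\delta>0$ and $\mu>1$ such that $d(f(x),f(y))\ge\mu\, d(x,y)$ whenever $x,y\in A$ and $d(x,y)<\delta$. $f$ is expanding on a neighbourhood of $\Lambda$ if there is a neighbourhood $U$ of $\Lambda$ such that $f$ is expanding on $U$. Ball expanding: $f$ is ball expanding on $A\subseteq X$ if there are $\mu>1$ and $\nu>0$ such that for every $x\in A$ and every $0<\varepsilon<\nu$ one has $B_{\mu\varepsilon}(f(x))\subseteq f(B_\varepsilon(x))$. A property holds "on a neighbourhood of $\Lambda$" if there is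 a neighbourhood $U$ of $\Lambda$ in $X$ such that it holds on $U$. *)

theory Defs
  imports "HOL-Analysis.Analysis"
begin

text \<open>
  The ambient space \<open>X\<close> is the type \<open>'a\<close>, so balls, interiors and neighbourhoods are
  those of the whole space. Neighbourhoods are not required to be open.
\<close>

definition nbhd_of :: "'a::topological_space set \<Rightarrow> 'a set \<Rightarrow> bool" where
  "nbhd_of U A \<longleftrightarrow> A \<subseteq> interior U"

definition open_at :: "('a::topological_space \<Rightarrow> 'b::topological_space) \<Rightarrow> 'a \<Rightarrow> bool" where
  "open_at f x \<longleftrightarrow> (\<forall>U. nbhd_of U {x} \<longrightarrow> f x \<in> interior (f ` U))"

text \<open>
  Openness is required at every point of \<open>A\<close> as a map on the whole space. This is not the
  statement that the restriction of \<open>f\<close> to \<open>A\<close> is an open map.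
\<close>

definition map_open_on :: "('a::topological_space \<Rightarrow> 'b::topological_space) \<Rightarrow> 'a set \<Rightarrow> bool" where
  "map_open_on f A \<longleftrightarrow> (\<forall>x\<in>A. open_at f x)"

definition locally_inj_at :: "('a::topological_space \<Rightarrow> 'b) \<Rightarrow> 'a \<Rightarrow> bool" where
  "locally_inj_at f x \<longleftrightarrow> (\<exists>V. open V \<and> x \<in> V \<and> inj_on f V)"

definition locally_inj_on :: "('a::topological_space \<Rightarrow> 'b) \<Rightarrow> 'a set \<Rightarrow> bool" where
  "locally_inj_on f A \<longleftrightarrow> (\<forall>x\<in>A. locally_inj_at f x)"

definition expanding_on :: "('a::metric_space \<Rightarrow> 'b::metric_space) \<Rightarrow> 'a set \<Rightarrow> bool" where
  "expanding_on f A \<longleftrightarrow>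
    (\<exists>\<delta>>0. \<exists>\<mu>>1. \<forall>x\<in>A. \<forall>y\<in>A. dist x y < \<delta> \<longrightarrow> dist (f x) (f y) \<ge> \<mu> * dist x y)"

definition ball_expanding_on :: "('a::metric_space \<Rightarrow> 'b::metric_space) \<Rightarrow> 'a set \<Rightarrow> bool" where
  "ball_expanding_on f A \<longleftrightarrow>
    (\<exists>\<mu>>1. \<exists>\<nu>>0. \<forall>x\<in>A. \<forall>\<epsilon>. 0 < \<epsilon> \<and> \<epsilon> < \<nu> \<longrightarrow> ball (f x) (\<mu> * \<epsilon>) \<subseteq> f ` ball x \<epsilon>)"

definition on_nbhd :: "('a::topological_space set \<Rightarrow> bool) \<Rightarrow> 'a set \<Rightarrow> bool" where
  "on_nbhd P \<Lambda> \<longleftrightarrow> (\<exists>U. nbhd_of U \<Lambda> \<and> P U)"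

end

theory Submission
  imports Defs
begin

text \<open>
  On a sufficiently small scale, expansion and injectivity identify preimages: if \<open>f y\<close> lies within
  \<open>\<mu> * \<epsilon>\<close> of \<open>f x\<close>, then openness provides a preimage of \<open>f y\<close> near \<open>x\<close>, and expansion forces it
  into the \<open>\<epsilon>\<close>-ball around \<open>x\<close>. Conversely, if expansion failed for \<open>x, y\<close>, then ball expansion
  would give a second preimage of \<open>f y\<close> strictly closer to \<open>x\<close> than \<open>y\<close>, against local injectivity.
  Compactness of \<open>\<Lambda>\<close> makes all the scales uniform.
\<close>

text \<open>A finite subcover has a smallest radius, and \<open>antimono\<close> lets it serve every
  member. The result holds on an open \<open>V\<close> around \<open>K\<close>, not merely on
  \<open>K\<close>, since the properties sought must hold on a neighbourhood.\<close>

lemma compact_uniform_radius: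
  fixes P :: "real \<Rightarrow> 'a::topological_space \<Rightarrow> bool"
  assumes "compact K"
    and local: "\<And>x. x \<in> K \<Longrightarrow> \<exists>r>0. \<exists>V. open V \<and> x \<in> V \<and> (\<forall>y\<in>V. P r y)"
    and antimono: "\<And>r s y. P r y \<Longrightarrow> 0 < s \<Longrightarrow> s \<le> r \<Longrightarrow> P s y"
  obtains r V where "r > 0" "open V" "K \<subseteq> V" "\<And>y. y \<in> V \<Longrightarrow> P r y"
proof -
  obtain r V where rV: "\<And>x. x \<in> K \<Longrightarrow> 0 < r x \<and> open (V x) \<and> x \<in> V x \<and> (\<forall>y\<in>V x. P (r x) y)"
    using local by metis
  obtain F where F: "F \<subseteq> K" "finite F" "K \<subseteq> (\<Union>x\<in>F. V x)"
    using compactE_image[OF \<open>compact K\<close>, of K V] rV by blast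
  \<comment> \<open>Inserting 1 keeps the minimum meaningful when \<open>F\<close> is empty, that
    is, when \<open>K\<close> may be empty.\<close>
  define m where "m = Min (insert 1 (r ` F))"
  have "m > 0" using F rV unfolding m_def by (subst Min_gr_iff) auto
  have m_le: "m \<le> r x" if "x \<in> F" for x
    using F that unfolding m_def by (intro Min_le) auto
  show ?thesis
  proof
    show "open (\<Union>x\<in>F. V x)" using F rV by blast
    show "P m y" if "y \<in> (\<Union>x\<in>F. V x)" for y
    proof -
      obtain x where "x \<in> F" "y \<in> V x" using \<open>y \<in> _\<close> by blast
      moreover from this have "P (r x) y" using rV F(1) by blast
      ultimately show ?thesis using antimono m_le \<open>m > 0\<close> by blast
    qed
  qed fact+
qed

text \<open>Half the radius of a ball around \<open>x\<close> inside \<open>U\<close> works for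
  every centre in the concentric ball of that half radius.\<close>

lemma compact_uniform_ball_subset:
  fixes K :: "'a::metric_space set"
  assumes "compact K" "open U" "K \<subseteq> U"
  obtains r V where "r > 0" "open V" "K \<subseteq> V" "\<And>y. y \<in> V \<Longrightarrow> ball y r \<subseteq> U"
proof (rule compact_uniform_radius[OF \<open>compact K\<close>, of "\<lambda>r y. ball y r \<subseteq> U"])
  fix x assume "x \<in> K"
  then obtain e where e: "e > 0" "ball x e \<subseteq> U"
    using assms open_contains_ball by blast
  have "ball y (e/2) \<subseteq> U" if "y \<in> ball x (e/2)" for y
    using that e(2) dist_triangle_half_r[of y _ e] by (force simp: dist_commute)
  then show "\<exists>r>0. \<exists>V. open V \<and> x \<in> V \<and> (\<forall>y\<in>V. ball y r \<subseteq> U)"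
    using e(1) by (intro exI[of _ "e/2"] conjI exI[of _ "ball x (e/2)"]) auto
next
  fix r s :: real and y
  assume "ball y r \<subseteq> U" "s \<le> r"
  then show "ball y s \<subseteq> U" using subset_ball by blast
qed (use that in blast)

lemma compact_uniform_inj:
  fixes K :: "'a::metric_space set"
  assumes "compact K" "locally_inj_on f K"
  obtains r V where "r > 0" "open V" "K \<subseteq> V" "\<And>y. y \<in> V \<Longrightarrow> inj_on f (ball y r)"
proof (rule compact_uniform_radius[OF \<open>compact K\<close>, of "\<lambda>r y. inj_on f (ball y r)"])
  fix x assume "x \<in> K"
  then obtain V where V: "open V" "x \<in> V" "inj_on f V"
    using assms(2) unfolding locally_inj_on_def locally_inj_at_def by blast
  \<comment> \<open>Applied to the compact set \<open>{x}\<close>, the previous lemma gives one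
    radius for all centres near \<open>x\<close>; injectivity on \<open>V\<close> is then inherited
    by those balls.\<close>
  obtain r W where "r > 0" "open W" "{x} \<subseteq> W" "\<And>y. y \<in> W \<Longrightarrow> ball y r \<subseteq> V"
  proof (rule compact_uniform_ball_subset[of "{x}" V])
    show "{x} \<subseteq> V" using V by simp
  qed (use V in simp_all)
  then show "\<exists>r>0. \<exists>V. open V \<and> x \<in> V \<and> (\<forall>y\<in>V. inj_on f (ball y r))"
    by (intro exI[of _ r] conjI exI[of _ W]) (auto intro: inj_on_subset[OF V(3)])
next
  fix r s :: real and y
  assume "inj_on f (ball y r)" "s \<le> r"
  then show "inj_on f (ball y s)" by (meson subset_ball inj_on_subset)
qed (use that in blast)

text \<open>Openness at a single point \<open>x\<close> controls nearby centres too: a ball about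
  \<open>f x\<close> lies in the image of a small ball about \<open>x\<close>, and continuity keeps
  \<open>f y\<close> well inside the former while \<open>y\<close> stays close to
  \<open>x\<close>.\<close>

lemma compact_uniform_open:
  fixes f :: "'a::metric_space \<Rightarrow> 'b::metric_space"
  assumes "compact K" "continuous_on UNIV f" "map_open_on f K" "s > 0"
  obtains r V where "r > 0" "open V" "K \<subseteq> V" "\<And>y. y \<in> V \<Longrightarrow> ball (f y) r \<subseteq> f ` ball y s"
proof (rule compact_uniform_radius[OF \<open>compact K\<close>, of "\<lambda>r y. ball (f y) r \<subseteq> f ` ball y s"])
  fix x assume "x \<in> K"
  have "nbhd_of (ball x (s/2)) {x}"
    using \<open>s > 0\<close> by (simp add: nbhd_of_def interior_open)
  then have "f x \<in> interior (f ` ball x (s/2))"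
    using assms(3) \<open>x \<in> K\<close> unfolding map_open_on_def open_at_def by blast
  then obtain e where e: "e > 0" "ball (f x) e \<subseteq> f ` ball x (s/2)"
    by (meson mem_interior)
  \<comment> \<open>The two conditions give the two ends of the chain
    \<open>ball (f y) (e/2)\<close> \<subseteq> \<open>ball (f x) e\<close> \<subseteq>
    \<open>f\<close> ball x (s/2)\<open>\<subseteq>\<close>f \<open>ball y s\<close>.\<close>
  define V where "V = ball x (s/2) \<inter> f -` ball (f x) (e/2)"
  have "open V"
    unfolding V_def using assms(2) by (intro open_Int open_vimage) auto
  moreover have "x \<in> V" using \<open>s > 0\<close> e by (simp add: V_def)
  moreover have "ball (f y) (e/2) \<subseteq> f ` ball y s" if "y \<in> V" for y
  proof -
    have "ball (f y) (e/2) \<subseteq> ball (f x) e"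
      using that dist_triangle_half_r[of "f y" _ e] by (auto simp: V_def dist_commute)
    also have "\<dots> \<subseteq> f ` ball x (s/2)" by (fact e(2))
    also have "ball x (s/2) \<subseteq> ball y s"
      using that dist_triangle_half_r[of x y s] by (auto simp: V_def)
    finally show ?thesis by blast
  qed
  ultimately show "\<exists>r>0. \<exists>V. open V \<and> x \<in> V \<and> (\<forall>y\<in>V. ball (f y) r \<subseteq> f ` ball y s)"
    using e(1) by (meson half_gt_zero)
next
  fix r t :: real and y
  assume "ball (f y) r \<subseteq> f ` ball y s" "t \<le> r"
  then show "ball (f y) t \<subseteq> f ` ball y s" using subset_ball by blast
qed (use that in blast)

lemma on_nbhd_map_open_onD: "on_nbhd (map_open_on f) A \<Longrightarrow> map_open_on f A"
  unfolding on_nbhd_def nbhd_of_def map_open_on_def using interior_subset by blast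

lemma on_nbhd_locally_inj_on_iff: "on_nbhd (locally_inj_on f) A \<longleftrightarrow> locally_inj_on f A"
proof
  assume "on_nbhd (locally_inj_on f) A"
  then show "locally_inj_on f A"
    unfolding on_nbhd_def nbhd_of_def locally_inj_on_def using interior_subset by blast
next
  assume A: "locally_inj_on f A"
  \<comment> \<open>This is the largest open set on which \<open>f\<close> is locally
    injective.\<close>
  define U where "U = \<Union>{V. open V \<and> inj_on f V}"
  have "open U" unfolding U_def by blast
  moreover have "A \<subseteq> U" using A unfolding U_def locally_inj_on_def locally_inj_at_def by blast
  moreover have "locally_inj_on f U"
    unfolding U_def locally_inj_on_def locally_inj_at_def by blast
  ultimately show "on_nbhd (locally_inj_on f) A"
    unfolding on_nbhd_def nbhd_of_def by (metis interior_open)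
qed

text \<open>Two points of a small enough ball are within the expansion scale, so equal images force
  their distance to be zero.\<close>

lemma expanding_imp_locally_inj:
  assumes "on_nbhd (expanding_on f) A"
  shows "locally_inj_on f A"
  unfolding locally_inj_on_def locally_inj_at_def
proof
  fix x assume "x \<in> A"
  obtain U \<delta> \<mu> where U: "A \<subseteq> interior U" and "\<delta> > 0" "\<mu> > 1"
    and ex: "\<And>x y. x \<in> U \<Longrightarrow> y \<in> U \<Longrightarrow> dist x y < \<delta> \<Longrightarrow> dist (f x) (f y) \<ge> \<mu> * dist x y"
    using assms unfolding on_nbhd_def nbhd_of_def expanding_on_def by blast
  have "inj_on f (interior U \<inter> ball x (\<delta>/2))"
  proof (rule inj_onI)
    fix y z
    assume yz: "y \<in> interior U \<inter> ball x (\<delta>/2)" "z \<in> interior U \<inter> ball x (\<delta>/2)" "f y = f z"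
    have "dist y z < \<delta>" by (rule dist_triangle_half_r[of x]) (use yz(1,2) in simp_all)
    moreover have "y \<in> U" "z \<in> U" using yz(1,2) interior_subset by blast+
    ultimately have "\<mu> * dist y z \<le> dist (f y) (f z)" by (intro ex)
    then have "\<mu> * dist y z \<le> 0" using yz(3) by simp
    then show "y = z"
      using \<open>\<mu> > 1\<close> by (simp add: mult_le_0_iff)
  qed
  moreover have "x \<in> interior U \<inter> ball x (\<delta>/2)" using U \<open>x \<in> A\<close> \<open>\<delta> > 0\<close> by auto
  moreover have "open (interior U \<inter> ball x (\<delta>/2))" by auto
  ultimately show "\<exists>V. open V \<and> x \<in> V \<and> inj_on f V" by blast
qed

lemma open_expanding_imp_ball_expanding:
  assumes "compact K" "continuous_on UNIV f"
    and "map_open_on f K" "on_nbhd (expanding_on f) K"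
  shows "on_nbhd (ball_expanding_on f) K"
proof -
  obtain U \<delta> \<mu> where U: "K \<subseteq> interior U" and "\<delta> > 0" "\<mu> > 1"
    and ex: "\<And>x y. x \<in> U \<Longrightarrow> y \<in> U \<Longrightarrow> dist x y < \<delta> \<Longrightarrow> dist (f x) (f y) \<ge> \<mu> * dist x y"
    using assms(4) unfolding on_nbhd_def nbhd_of_def expanding_on_def by blast
  obtain r V where V: "r > 0" "open V" "K \<subseteq> V" "\<And>y. y \<in> V \<Longrightarrow> ball y r \<subseteq> interior U"
    using compact_uniform_ball_subset[OF assms(1) open_interior U] by blast
  \<comment> \<open>At this scale a preimage found in \<open>ball x s\<close> lies in
    \<open>U\<close> and within \<open>\<delta>\<close> of \<open>x\<close>, so the expansion
    estimate applies to it.\<close>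
  define s where "s = min r \<delta>"
  have "s > 0" using V \<open>\<delta> > 0\<close> by (simp add: s_def)
  obtain t W where W: "t > 0" "open W" "K \<subseteq> W" "\<And>y. y \<in> W \<Longrightarrow> ball (f y) t \<subseteq> f ` ball y s"
    using compact_uniform_open[OF assms(1-3) \<open>s > 0\<close>] by blast
  \<comment> \<open>The bound \<open>t / \<mu>\<close> puts the target ball inside
    \<open>ball (f x) t\<close>, where preimages are available in \<open>ball x s\<close>; expansion
    then pulls them into \<open>ball x \<epsilon>\<close>.\<close>
  have "ball (f x) (\<mu> * \<epsilon>) \<subseteq> f ` ball x \<epsilon>" if x: "x \<in> V \<inter> W" and "\<epsilon> < t / \<mu>" for x \<epsilon>
  proof
    fix w assume w: "w \<in> ball (f x) (\<mu> * \<epsilon>)"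
    have "\<mu> * \<epsilon> < t" using \<open>\<epsilon> < t / \<mu>\<close> \<open>\<mu> > 1\<close> by (simp add: field_simps)
    then have "w \<in> ball (f x) t" using w by simp
    then obtain z where z: "z \<in> ball x s" "w = f z" using W x by blast
    then have "z \<in> U" "x \<in> U" "dist x z < \<delta>"
      using V(4)[of x] V(1) x interior_subset[of U] by (auto simp: s_def subset_iff)
    then have "\<mu> * dist x z < \<mu> * \<epsilon>"
      using ex[of x z] w z by simp
    then have "dist x z < \<epsilon>" using \<open>\<mu> > 1\<close> by simp
    then show "w \<in> f ` ball x \<epsilon>" using z by auto
  qed
  then have "ball_expanding_on f (V \<inter> W)"
    unfolding ball_expanding_on_def using W(1) \<open>\<mu> > 1\<close>
    by (intro exI[of _ \<mu>] conjI exI[of _ "t / \<mu>"]) auto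
  moreover have "K \<subseteq> interior (V \<inter> W)" using V W by (simp add: interior_open open_Int)
  ultimately show ?thesis
    unfolding on_nbhd_def nbhd_of_def by blast
qed

lemma ball_expanding_imp_map_open_on:
  assumes "ball_expanding_on f A"
  shows "map_open_on f A"
  unfolding map_open_on_def open_at_def nbhd_of_def
proof (intro ballI allI impI)
  fix x U assume x: "x \<in> A" "{x} \<subseteq> interior U"
  obtain \<mu> \<nu> where "\<mu> > 1" "\<nu> > 0"
    and be: "\<And>x \<epsilon>. x \<in> A \<Longrightarrow> 0 < \<epsilon> \<Longrightarrow> \<epsilon> < \<nu> \<Longrightarrow> ball (f x) (\<mu> * \<epsilon>) \<subseteq> f ` ball x \<epsilon>"
    using assms unfolding ball_expanding_on_def by blast
  obtain e where e: "e > 0" "ball x e \<subseteq> U" using x by (auto simp: mem_interior)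
  \<comment> \<open>Halving \<open>\<nu>\<close> secures the strict inequality that ball expansion
    demands.\<close>
  define \<epsilon> where "\<epsilon> = min e (\<nu>/2)"
  have "0 < \<epsilon>" "\<epsilon> < \<nu>" "\<epsilon> \<le> e" using e \<open>\<nu> > 0\<close> by (auto simp: \<epsilon>_def)
  then have "ball (f x) (\<mu> * \<epsilon>) \<subseteq> f ` U"
    using be[OF x(1)] e(2) subset_ball[of \<epsilon> e x] by blast
  moreover have "\<mu> * \<epsilon> > 0" using \<open>\<mu> > 1\<close> \<open>0 < \<epsilon>\<close> by simp
  ultimately show "f x \<in> interior (f ` U)"
    by (meson mem_interior)
qed

lemma ball_expanding_imp_expanding:
  assumes "compact K" "on_nbhd (ball_expanding_on f) K" "locally_inj_on f K"
  shows "on_nbhd (expanding_on f) K"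
proof -
  obtain U \<mu> \<nu> where U: "K \<subseteq> interior U" and "\<mu> > 1" "\<nu> > 0"
    and be: "\<And>x \<epsilon>. x \<in> U \<Longrightarrow> 0 < \<epsilon> \<Longrightarrow> \<epsilon> < \<nu> \<Longrightarrow> ball (f x) (\<mu> * \<epsilon>) \<subseteq> f ` ball x \<epsilon>"
    using assms(2) unfolding on_nbhd_def nbhd_of_def ball_expanding_on_def by blast
  obtain r V where V: "r > 0" "open V" "K \<subseteq> V" "\<And>y. y \<in> V \<Longrightarrow> inj_on f (ball y r)"
    using compact_uniform_inj[OF assms(1,3)] by blast
  have "\<mu> * dist x y \<le> dist (f x) (f y)"
    if x: "x \<in> U \<inter> V" and d: "dist x y < min \<nu> r" for x y
  proof (rule ccontr)
    assume less: "\<not> \<mu> * dist x y \<le> dist (f x) (f y)"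
    then have "0 < dist x y" by auto
    then have "ball (f x) (\<mu> * dist x y) \<subseteq> f ` ball x (dist x y)" using be x d by simp
    moreover have "f y \<in> ball (f x) (\<mu> * dist x y)" using less by simp
    ultimately obtain z where z: "dist x z < dist x y" "f z = f y" by fastforce
    then have "z = y" using inj_onD[OF V(4), of x z y] x d by simp
    then show False using z by simp
  qed
  then have "expanding_on f (U \<inter> V)"
    unfolding expanding_on_def using V(1) \<open>\<mu> > 1\<close> \<open>\<nu> > 0\<close>
    by (intro exI[of _ "min \<nu> r"] conjI exI[of _ \<mu>]) auto
  moreover have "K \<subseteq> interior (U \<inter> V)" using U V by (simp add: interior_open)
  ultimately show ?thesis
    unfolding on_nbhd_def nbhd_of_def by blast
qed

theorem theorem2p5:
  fixes f :: "'a::metric_space \<Rightarrow> 'a" and \<Lambda> :: "'a set"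
  assumes "compact (UNIV :: 'a set)"
    and "continuous_on UNIV f"
    and "closed \<Lambda>"
  shows "((on_nbhd (map_open_on f) \<Lambda> \<and> on_nbhd (expanding_on f) \<Lambda>) \<longleftrightarrow>
          (on_nbhd (ball_expanding_on f) \<Lambda> \<and> locally_inj_on f \<Lambda>)) \<and>
         (locally_inj_on f \<Lambda> \<longleftrightarrow> on_nbhd (locally_inj_on f) \<Lambda>)"
proof -
  have "compact \<Lambda>" using compact_Int_closed[OF assms(1,3)] by simp
  moreover have "on_nbhd (map_open_on f) \<Lambda>" if "on_nbhd (ball_expanding_on f) \<Lambda>"
    using that ball_expanding_imp_map_open_on unfolding on_nbhd_def by blast
  ultimately show ?thesis
    using assms(2) open_expanding_imp_ball_expanding on_nbhd_map_open_onD expanding_imp_locally_inj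
      ball_expanding_imp_expanding on_nbhd_locally_inj_on_iff
    by metis
qed

end
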